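(* For every positive integer $n$ and every $I\subseteq[n-1]$, $$|\{\pi\in\mathcal{C}_{n+1} : D(\pi)\cap[n-1]=I\}|=|\{\sigma\in\mathcal{S}_n : D(\sigma)=I\}|.$$
   Context: $[n]=\{1,2,\dots,n\}$; $\mathcal{S}_n$ is the set of permutations of $[n]$; $\mathcal{C}_n\subseteq\mathcal{S}_n$ is the set of permutations consisting of one single cycle of length $n$. For $\pi\in\mathcal{S}_n$, $D(\pi)=\{i : 1\le i\le n-1,\ \pi(i)>\pi(i+1)\}$. *)

theory Defs
  imports "HOL-Combinatorics.Combinatorics"
begin

definition sym_perms :: "nat \<Rightarrow> (nat \<Rightarrow> nat) set" where
  "sym_perms n = {p. p permutes {1..n}}"

(* cyclic_on p {1..n} says that {1..n} is a single orbit of p, so this is the set of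
   permutations of {1..n} that are one cycle of length n (for n = 1: the identity). *)
definition cyc_perms :: "nat \<Rightarrow> (nat \<Rightarrow> nat) set" where
  "cyc_perms n = {p \<in> sym_perms n. cyclic_on p {1..n}}"

(* The size n is an explicit argument because p, as a function on all of nat,
   does not determine it. *)
definition descent_set :: "nat \<Rightarrow> (nat \<Rightarrow> nat) \<Rightarrow> nat set" where
  "descent_set n p = {i. 1 \<le> i \<and> i \<le> n - 1 \<and> p i > p (i + 1)}"

end

theory Submission
  imports Defs "HOL-Library.Product_Lexorder" "HOL-Library.List_Lexorder"
begin

text \<open>
  Both sides are compared through words, following Gessel and Reutenauer. By inclusion-exclusion
  it suffices to count permutations whose descents in \<open>[n - 1]\<close> are contained in \<open>I\<close>, that is,
  permutations that are increasing on each of the blocks into which \<open>I\<close> cuts \<open>[n]\<close>. A permutation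
  \<open>\<sigma>\<close> of this kind is determined by the word recording the block of \<open>\<sigma>\<^sup>-\<^sup>1(j)\<close>. A cyclic \<open>\<pi>\<close> of this
  kind is determined by the itinerary of \<open>n + 1\<close>, the word recording the block of \<open>\<pi>\<^sup>j(n + 1)\<close> for
  \<open>j = 1, \<dots>, n\<close>: the points of the orbit are ordered like the suffixes of this word, where the
  missing last letter, belonging to \<open>n + 1\<close> itself, is larger than all others. In both cases exactly
  the words in which every block occurs as often as it has elements arise.
\<close>

section \<open>Ranks\<close>

text \<open>Counting with \<open>\<le>\<close> makes ranks start at 1, so for an injective key they
  are positions in \<open>{1..card A}\<close>.\<close>

definition rank :: "('a \<Rightarrow> 'b::linorder) \<Rightarrow> 'a set \<Rightarrow> 'a \<Rightarrow> nat" where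
  "rank c A j = card {k \<in> A. c k \<le> c j}"

lemma rank_cong:
  assumes "\<And>k. k \<in> A \<Longrightarrow> c k = d k" "j \<in> A"
  shows "rank c A j = rank d A j"
proof -
  have "{k \<in> A. c k \<le> c j} = {k \<in> A. d k \<le> d j}"
    using assms(1)[OF assms(2)] assms(1) by (intro Collect_cong conj_cong) simp_all
  then show ?thesis by (simp add: rank_def)
qed

lemma rank_strict_mono:
  assumes "finite A" "k \<in> A" "c j < c k"
  shows "rank c A j < rank c A k"
  unfolding rank_def
proof (rule psubset_card_mono)
  show "{i \<in> A. c i \<le> c j} \<subset> {i \<in> A. c i \<le> c k}"
    using assms by force
qed (use assms in auto)

lemma rank_less_iff:
  assumes "finite A" "j \<in> A" "k \<in> A"
  shows "rank c A j < rank c A k \<longleftrightarrow> c j < c k"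
proof
  assume less: "rank c A j < rank c A k"
  show "c j < c k"
  proof (rule ccontr)
    assume "\<not> c j < c k"
    then have "{i \<in> A. c i \<le> c k} \<subseteq> {i \<in> A. c i \<le> c j}" by auto
    then have "rank c A k \<le> rank c A j"
      unfolding rank_def using assms by (intro card_mono) auto
    with less show False by simp
  qed
qed (rule rank_strict_mono[OF assms(1,3)])

lemma bij_betw_rank:
  assumes "finite A" "inj_on c A"
  shows "bij_betw (rank c A) A {1..card A}"
proof -
  have inj: "inj_on (rank c A) A"
  proof (rule inj_onI)
    fix j k assume "j \<in> A" "k \<in> A" "rank c A j = rank c A k"
    then show "j = k"
      using assms rank_less_iff[of A j k c] rank_less_iff[of A k j c]
      by (metis inj_onD less_irrefl linorder_neqE)
  qed
  have "rank c A ` A \<subseteq> {1..card A}"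
  proof
    fix x assume "x \<in> rank c A ` A"
    then obtain j where j: "j \<in> A" "x = card {k \<in> A. c k \<le> c j}" by (auto simp: rank_def)
    then have "{k \<in> A. c k \<le> c j} \<noteq> {}" by blast
    with j assms have "x > 0" by (simp add: card_gt_0_iff)
    moreover have "x \<le> card A" using j assms by (auto intro: card_mono)
    ultimately show "x \<in> {1..card A}" by simp
  qed
  moreover have "card (rank c A ` A) = card {1..card A}" using card_image[OF inj] by simp
  ultimately have "rank c A ` A = {1..card A}" by (intro card_subset_eq) auto
  with inj show ?thesis by (simp add: bij_betw_def)
qed

text \<open>The elements with key at most \<open>c j\<close> are exactly those that \<open>r\<close>
  maps into \<open>{1..r j}\<close>, so the order of the keys forces \<open>r\<close>. Both
  injectivity proofs below recover a permutation from its word in this way.\<close>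

lemma rank_unique:
  assumes "inj_on c A" "bij_betw r A {1..m}" "j \<in> A"
    and mono: "\<And>j k. j \<in> A \<Longrightarrow> k \<in> A \<Longrightarrow> c j < c k \<Longrightarrow> r j < r k"
  shows "r j = rank c A j"
proof -
  have "{k \<in> A. c k \<le> c j} = {k \<in> A. r k \<le> r j}"
    using mono assms(1,3) by (metis inj_onD leD leI order.order_iff_strict)
  moreover have "r ` {k \<in> A. r k \<le> r j} = {1..r j}"
  proof -
    have "r ` A = {1..m}" "r j \<le> m" using assms(2,3) by (auto simp: bij_betw_def)
    show ?thesis
    proof
      show "{1..r j} \<subseteq> r ` {k \<in> A. r k \<le> r j}"
      proof
        fix x assume x: "x \<in> {1..r j}"
        then have "x \<in> r ` A" using \<open>r ` A = {1..m}\<close> \<open>r j \<le> m\<close> by simp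
        then show "x \<in> r ` {k \<in> A. r k \<le> r j}" using x by auto
      qed
    qed (use \<open>r ` A = {1..m}\<close> in auto)
  qed
  moreover have "inj_on r {k \<in> A. r k \<le> r j}"
    using assms(2) by (auto simp: bij_betw_def inj_on_def)
  ultimately show ?thesis by (simp add: rank_def card_image[symmetric])
qed

section \<open>Words with prescribed letter counts\<close>

definition same_count :: "nat set \<Rightarrow> (nat \<Rightarrow> nat) \<Rightarrow> (nat \<Rightarrow> nat) \<Rightarrow> bool" where
  "same_count A w b \<longleftrightarrow> (\<forall>v. card {j \<in> A. w j = v} = card {p \<in> A. b p = v})"

text \<open>These are the rearrangements of the word \<open>b 1, ..., b n\<close>. Requiring
  \<open>extensional\<close> makes a word, as a function on \<open>nat\<close>, determined by its
  letters.\<close>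

definition words :: "nat \<Rightarrow> (nat \<Rightarrow> nat) \<Rightarrow> (nat \<Rightarrow> nat) set" where
  "words n b = {w \<in> extensional {1..n}. same_count {1..n} w b}"

definition block_increasing :: "nat \<Rightarrow> (nat \<Rightarrow> nat) \<Rightarrow> (nat \<Rightarrow> nat) \<Rightarrow> bool" where
  "block_increasing n b s \<longleftrightarrow>
    (\<forall>p\<in>{1..n}. \<forall>q\<in>{1..n}. p < q \<longrightarrow> b p = b q \<longrightarrow> s p < s q)"

lemma same_count_bij:
  assumes r: "bij_betw r A A" and w: "\<And>j. j \<in> A \<Longrightarrow> w j = b (r j)"
  shows "same_count A w b"
  unfolding same_count_def
proof
  fix v
  have "r ` {j \<in> A. w j = v} = {p \<in> A. b p = v}"
  proof
    show "{p \<in> A. b p = v} \<subseteq> r ` {j \<in> A. w j = v}"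
    proof
      fix p assume p: "p \<in> {p \<in> A. b p = v}"
      then obtain j where "j \<in> A" "p = r j" using r by (auto simp: bij_betw_def)
      then show "p \<in> r ` {j \<in> A. w j = v}" using p w by auto
    qed
  qed (use r w in \<open>auto simp: bij_betw_def\<close>)
  moreover have "inj_on r {j \<in> A. w j = v}"
    using r by (auto simp: bij_betw_def inj_on_def)
  ultimately show "card {j \<in> A. w j = v} = card {p \<in> A. b p = v}"
    using card_image[of r "{j \<in> A. w j = v}"] by simp
qed

lemma same_count_le:
  assumes "finite A" "same_count A w b"
  shows "card {j \<in> A. w j \<le> v} = card {p \<in> A. b p \<le> v}"
proof -
  have "card {j \<in> A. f j \<le> v} = (\<Sum>u\<le>v. card {j \<in> A. f j = u})" for f :: "nat \<Rightarrow> nat"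
  proof -
    have "{j \<in> A. f j \<le> v} = (\<Union>u\<in>{..v}. {j \<in> A. f j = u})" by auto
    then show ?thesis using assms(1) by (simp add: card_UN_disjoint disjoint_iff)
  qed
  then show ?thesis using assms(2) by (simp add: same_count_def)
qed

text \<open>The map \<open>r\<close> sorts the positions of \<open>w\<close>, and the sorted
  rearrangement of \<open>w\<close> must be the monotone word \<open>b\<close>. If the letters at
  \<open>r j\<close> disagreed, counting letters up to a threshold in \<open>w\<close> and in
  \<open>b\<close> would leave only \<open>r j - 1\<close> places for \<open>r j\<close>
  elements.\<close>

lemma block_of_sorted_position:
  assumes "mono b" and count: "same_count {1..n} w b"
    and r: "bij_betw r {1..n} {1..n}"
    and mono: "\<And>j k. j \<in> {1..n} \<Longrightarrow> k \<in> {1..n} \<Longrightarrow> w j < w k \<Longrightarrow> r j < r k"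
    and j: "j \<in> {1..n}"
  shows "b (r j) = w j"
proof -
  have eq: "card {k \<in> {1..n}. w k \<le> v} = card {p \<in> {1..n}. b p \<le> v}" for v
    using same_count_le[OF _ count] by simp
  have rj: "r j \<in> {1..n}" using r j by (auto simp: bij_betw_def)
  have inj: "inj_on r {1..n}" using r by (simp add: bij_betw_def)
  show ?thesis
  proof (rule linorder_cases[of "b (r j)" "w j"])
    assume less: "b (r j) < w j"
    have "r j = card {1..r j}" by simp
    also have "\<dots> \<le> card {p \<in> {1..n}. b p \<le> b (r j)}"
      using rj by (intro card_mono) (auto intro: monoD[OF \<open>mono b\<close>])
    also have "\<dots> = card {k \<in> {1..n}. w k \<le> b (r j)}" by (simp only: eq)
    also have "\<dots> = card (r ` {k \<in> {1..n}. w k \<le> b (r j)})"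
      by (intro card_image[symmetric] inj_on_subset[OF inj]) auto
    \<comment> \<open>Each such \<open>k\<close> has a letter smaller than \<open>w j\<close>, so
      \<open>r\<close> places it strictly before \<open>r j\<close>.\<close>
    also have "\<dots> \<le> card {1..<r j}"
    proof (rule card_mono)
      show "r ` {k \<in> {1..n}. w k \<le> b (r j)} \<subseteq> {1..<r j}"
      proof
        fix x assume "x \<in> r ` {k \<in> {1..n}. w k \<le> b (r j)}"
        then obtain k where k: "k \<in> {1..n}" "w k \<le> b (r j)" "x = r k" by blast
        then show "x \<in> {1..<r j}" using mono[of k j] less j r by (auto simp: bij_betw_def)
      qed
    qed simp
    finally have "r j \<le> r j - 1" by simp
    then have False using rj by auto
    then show ?thesis ..
  next
    assume less: "w j < b (r j)"
    have "r j = card {1..r j}" by simp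
    \<comment> \<open>Whatever \<open>r\<close> places at or before \<open>r j\<close> has a letter
      at most \<open>w j\<close>.\<close>
    also have "\<dots> \<le> card (r ` {k \<in> {1..n}. w k \<le> w j})"
    proof (rule card_mono)
      show "{1..r j} \<subseteq> r ` {k \<in> {1..n}. w k \<le> w j}"
      proof
        fix x assume x: "x \<in> {1..r j}"
        then have "x \<in> r ` {1..n}" using rj r by (auto simp: bij_betw_def)
        then obtain k where k: "k \<in> {1..n}" "x = r k" by blast
        then have "\<not> w j < w k" using mono[of j k] x j by auto
        then show "x \<in> r ` {k \<in> {1..n}. w k \<le> w j}" using k by auto
      qed
    qed simp
    also have "\<dots> = card {k \<in> {1..n}. w k \<le> w j}"
      by (intro card_image inj_on_subset[OF inj]) auto
    also have "\<dots> = card {p \<in> {1..n}. b p \<le> w j}" by (simp only: eq)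
    also have "\<dots> \<le> card {1..<r j}"
    proof (rule card_mono)
      show "{p \<in> {1..n}. b p \<le> w j} \<subseteq> {1..<r j}"
        using less monoD[OF \<open>mono b\<close>, of "r j"] by (force simp: not_le[symmetric])
    qed simp
    finally have "r j \<le> r j - 1" by simp
    then have False using rj by auto
    then show ?thesis ..
  qed simp
qed

section \<open>Permutations and words\<close>

text \<open>The inverse of this map is standardization: sorting the positions of a word by letter,
  with ties broken from left to right, yields the inverse of the permutation.\<close>

lemma bij_betw_perm_words:
  assumes "mono b"
  shows "bij_betw (\<lambda>s. restrict (\<lambda>j. b (inv s j)) {1..n})
    {s. s permutes {1..n} \<and> block_increasing n b s} (words n b)"
    (is "bij_betw ?F ?S _")
proof (rule bij_betw_imageI)
  \<comment> \<open>Across blocks the values of \<open>inv s\<close> are ordered like their labels;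
    within a block \<open>s\<close> is increasing, so smaller \<open>j\<close> have smaller
    preimages. Hence the word alone determines \<open>inv s\<close>.\<close>
  have inv_rank: "inv s j = rank (\<lambda>j. (b (inv s j), j)) {1..n} j"
    if s: "s permutes {1..n}" "block_increasing n b s" and j: "j \<in> {1..n}" for s j
  proof (rule rank_unique)
    show "inj_on (\<lambda>j. (b (inv s j), j)) {1..n}" by (auto simp: inj_on_def)
    show "bij_betw (inv s) {1..n} {1..n}" using permutes_imp_bij[OF permutes_inv[OF s(1)]] .
    fix j k assume jk: "j \<in> {1..n}" "k \<in> {1..n}" and "(b (inv s j), j) < (b (inv s k), k)"
    from this(3) consider "b (inv s j) < b (inv s k)" | "b (inv s j) = b (inv s k)" "j < k"
      by (auto simp: less_prod_def le_less)
    then show "inv s j < inv s k"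
    proof cases
      case 1
      then show ?thesis using monoD[OF assms, of "inv s k" "inv s j"] by fastforce
    next
      case 2
      have "inv s j \<in> {1..n}" "inv s k \<in> {1..n}"
        using jk permutes_in_image[OF permutes_inv[OF s(1)]] by blast+
      then have "s (inv s k) < s (inv s j)" if "inv s k < inv s j"
        using s(2) 2(1) that by (auto simp: block_increasing_def)
      moreover have "inv s j \<noteq> inv s k" using 2(2) permutes_inverses(1)[OF s(1)] by (metis less_irrefl)
      ultimately show ?thesis using 2(2) permutes_inverses(1)[OF s(1)] by fastforce
    qed
  qed (use j in auto)
  show "inj_on ?F ?S"
  proof (rule inj_onI)
    fix s t assume s: "s \<in> ?S" and t: "t \<in> ?S" and eq: "?F s = ?F t"
    have "b (inv s j) = b (inv t j)" if "j \<in> {1..n}" for j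
      using fun_cong[OF eq, of j] that by simp
    then have "rank (\<lambda>j. (b (inv s j), j)) {1..n} j = rank (\<lambda>j. (b (inv t j), j)) {1..n} j"
      if "j \<in> {1..n}" for j
      using that by (intro rank_cong) auto
    then have "inv s j = inv t j" if "j \<in> {1..n}" for j
      using s t inv_rank[of s j] inv_rank[of t j] that by simp
    moreover have "inv s j = inv t j" if "j \<notin> {1..n}" for j
      using s t that permutes_inv permutes_not_in by (metis mem_Collect_eq)
    ultimately have "inv s = inv t" by blast
    then show "s = t" using s t permutes_inv_inv by (metis mem_Collect_eq)
  qed
  show "?F ` ?S = words n b"
  proof (intro equalityI subsetI)
    fix w assume "w \<in> ?F ` ?S"
    then obtain s where s: "s permutes {1..n}" "w = ?F s" by blast
    then show "w \<in> words n b"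
      using same_count_bij[OF permutes_imp_bij[OF permutes_inv[OF s(1)]], of w b]
      by (simp add: words_def)
  next
    fix w assume w: "w \<in> words n b"
    define c where "c j = (w j, j)" for j
    define r where "r = rank c {1..n}"
    have r: "bij_betw r {1..n} {1..n}"
      using bij_betw_rank[of "{1..n}" c] by (simp add: r_def c_def inj_on_def)
    have less: "r j < r k \<longleftrightarrow> c j < c k" if "j \<in> {1..n}" "k \<in> {1..n}" for j k
      using that by (simp add: r_def rank_less_iff)
    have block: "b (r j) = w j" if "j \<in> {1..n}" for j
      using block_of_sorted_position[OF assms _ r _ that, of w] w less
      by (simp add: words_def c_def)
    \<comment> \<open>\<open>permutes\<close> demands the identity outside \<open>{1..n}\<close>.
      The preimage of \<open>w\<close> will be \<open>inv u\<close>, since the word is read off the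
      inverse permutation.\<close>
    define u where "u j = (if j \<in> {1..n} then r j else j)" for j
    have u: "u permutes {1..n}"
    proof (rule bij_imp_permutes)
      show "bij_betw u {1..n} {1..n}"
        using r by (rule bij_betw_cong[THEN iffD1, rotated]) (simp add: u_def)
    qed (auto simp: u_def)
    have inc: "block_increasing n b (inv u)"
      unfolding block_increasing_def
    proof (intro ballI impI)
      fix p q assume pq: "p \<in> {1..n}" "q \<in> {1..n}" "p < q" "b p = b q"
      let ?j = "inv u p" and ?k = "inv u q"
      have jk: "?j \<in> {1..n}" "?k \<in> {1..n}"
        using pq(1,2) by (simp_all only: permutes_in_image[OF permutes_inv[OF u]])
      have "u ?j = p" "u ?k = q"
        by (simp_all only: permutes_inverses(1)[OF u])
      then have "r ?j = p" "r ?k = q"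
        using jk by (simp_all only: u_def if_True)
      then have "w ?j = w ?k" "c ?j < c ?k" using block[OF jk(1)] block[OF jk(2)] pq less[OF jk] by auto
      then show "?j < ?k" by (simp add: c_def)
    qed
    have "?F (inv u) = w"
      using w by (intro extensionalityI[of _ "{1..n}"])
        (auto simp: words_def permutes_inv_inv[OF u] u_def block)
    then show "w \<in> ?F ` ?S" using inc permutes_inv[OF u] by blast
  qed
qed

section \<open>Cyclic permutations and words\<close>

text \<open>Exponents run from 1 to \<open>m\<close>, so that the base point \<open>m\<close> has
  index \<open>m\<close>; index and point can later be deleted together.\<close>

lemma cyc_perms_funpow:
  assumes p: "p \<in> cyc_perms m" and "m > 0"
  shows "bij_betw (\<lambda>j. (p ^^ j) m) {1..m} {1..m}" "(p ^^ m) m = m"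
proof -
  have cyc: "cyclic_on p {1..m}" using p by (simp add: cyc_perms_def)
  have orb: "orbit p m = {1..m}" using orbit_cyclic_eq3[OF cyc] \<open>m > 0\<close> by simp
  then have self: "m \<in> orbit p m" using \<open>m > 0\<close> by simp
  \<comment> \<open>The least positive exponent that returns \<open>m\<close> to itself, that is,
    the length of the cycle.\<close>
  let ?d = "funpow_dist1 p m m"
  have img: "{1..m} = (\<lambda>j. (p ^^ j) m) ` {0..<?d}"
    using orbit_conv_funpow_dist1[OF self] orb by simp
  then have "?d = m"
    using card_image[OF inj_on_funpow_dist1[OF self]] by (metis card_atLeastAtMost card_atLeastLessThan diff_Suc_1 diff_zero)
  then show pm: "(p ^^ m) m = m" using funpow_dist1_prop[OF self] by metis
  have "(\<lambda>j. (p ^^ j) m) ` {1..m} = {1..m}"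
  proof
    show "(\<lambda>j. (p ^^ j) m) ` {1..m} \<subseteq> {1..m}"
      using cyclic_on_funpow_in[OF cyc, of m] \<open>m > 0\<close> by auto
    show "{1..m} \<subseteq> (\<lambda>j. (p ^^ j) m) ` {1..m}"
    proof
      fix x assume "x \<in> {1..m}"
      then have "x \<in> (\<lambda>j. (p ^^ j) m) ` {0..<m}" using img \<open>?d = m\<close> by metis
      then obtain j where j: "j < m" "x = (p ^^ j) m" by auto
      \<comment> \<open>Exponent 0 lies outside the index range and is replaced by
        \<open>m\<close>.\<close>
      show "x \<in> (\<lambda>j. (p ^^ j) m) ` {1..m}"
      proof (cases "j = 0")
        case True
        then have "x = (p ^^ m) m" using j pm by simp
        then show ?thesis using \<open>m > 0\<close> by (intro image_eqI[of _ _ m]) auto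
      qed (use j in auto)
    qed
  qed
  then show "bij_betw (\<lambda>j. (p ^^ j) m) {1..m} {1..m}"
    by (auto simp: bij_betw_def intro!: eq_card_imp_inj_on)
qed

text \<open>The final letter, larger than all letters of \<open>w\<close>, makes all suffixes comparable
  at a position where they differ.\<close>

definition suffix_code :: "nat \<Rightarrow> (nat \<Rightarrow> nat) \<Rightarrow> nat \<Rightarrow> nat list" where
  "suffix_code n w j = map w [j..<n + 1] @ [Suc (\<Sum>i\<in>{1..n}. w i)]"

text \<open>Itineraries are restricted to \<open>{1..n}\<close>; suffixes starting at 1 or later do
  not see the restriction.\<close>

lemma suffix_code_cong:
  assumes "\<And>i. i \<in> {1..n} \<Longrightarrow> w i = w' i" "j \<ge> 1"
  shows "suffix_code n w j = suffix_code n w' j"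
proof -
  have "(\<Sum>i\<in>{1..n}. w i) = (\<Sum>i\<in>{1..n}. w' i)"
    by (rule sum.cong[OF refl assms(1)])
  moreover have "map w [j..<n + 1] = map w' [j..<n + 1]"
    using assms(2) by (intro map_cong refl assms(1)) (simp del: upt_Suc)
  ultimately show ?thesis by (simp only: suffix_code_def)
qed

lemma suffix_code_Cons:
  assumes "j \<le> n"
  shows "suffix_code n w j = w j # suffix_code n w (j + 1)"
proof -
  have "[j..<n + 1] = j # [j + 1..<n + 1]" using assms by (subst upt_conv_Cons) simp_all
  then show ?thesis unfolding suffix_code_def by (simp only: list.map append_Cons)
qed

text \<open>The sum bounds each single letter, so the first letter already loses against the
  sentinel.\<close>

lemma suffix_code_less_last:
  assumes "j \<in> {1..n}"
  shows "suffix_code n w j < suffix_code n w (n + 1)"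
proof -
  have "w j \<le> (\<Sum>i\<in>{1..n}. w i)" using assms by (intro member_le_sum) auto
  moreover have "suffix_code n w (n + 1) = [Suc (\<Sum>i\<in>{1..n}. w i)]"
    by (simp add: suffix_code_def)
  moreover have "suffix_code n w j = w j # suffix_code n w (j + 1)"
    using assms by (intro suffix_code_Cons) simp
  ultimately show ?thesis by (simp only: Cons_less_Cons) simp
qed

text \<open>Suffixes with different starting points have different lengths.\<close>

lemma inj_on_suffix_code: "inj_on (suffix_code n w) {1..n + 1}"
proof (rule inj_onI)
  fix j k assume "j \<in> {1..n + 1}" "k \<in> {1..n + 1}" "suffix_code n w j = suffix_code n w k"
  moreover from this have "length (suffix_code n w j) = length (suffix_code n w k)" by simp
  then have "n + 1 - j = n + 1 - k" by (simp add: suffix_code_def del: upt_Suc)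
  ultimately show "j = k" by auto
qed

text \<open>Points in different blocks are ordered by their labels, as \<open>b\<close> is monotone.
  Points in a common block keep their order under \<open>p\<close>, so the comparison passes to
  their images, which amounts to deleting the equal first letters of the two suffixes.\<close>

lemma funpow_less_of_suffix_code_less:
  fixes b p n defines "w \<equiv> \<lambda>j. b ((p ^^ j) (n + 1))"
  assumes p: "p \<in> cyc_perms (n + 1)" "block_increasing n b p" and "mono b"
    and "j \<in> {1..n + 1}" "k \<in> {1..n + 1}" "suffix_code n w j < suffix_code n w k"
  shows "(p ^^ j) (n + 1) < (p ^^ k) (n + 1)"
  using assms(5-7)
\<comment> \<open>The measure is \<open>(n + 1 - j) + (n + 1 - k)\<close>, the number of letters
  before the two sentinels.\<close>
proof (induction "2 * n + 2 - j - k" arbitrary: j k rule: less_induct)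
  case less
  let ?x = "\<lambda>j. (p ^^ j) (n + 1)"
  have bij: "bij_betw ?x {1..n + 1} {1..n + 1}" and last: "?x (n + 1) = n + 1"
    using cyc_perms_funpow[OF p(1)] by auto
  have mem: "?x i \<in> {1..n + 1}" if "i \<in> {1..n + 1}" for i
    using bij that by (auto simp: bij_betw_def)
  have inj: "?x i = ?x i' \<longleftrightarrow> i = i'" if "i \<in> {1..n + 1}" "i' \<in> {1..n + 1}" for i i'
    using bij that by (auto simp: bij_betw_def dest: inj_onD)
  have mem': "?x i \<in> {1..n}" if "i \<in> {1..n}" for i
    using mem[of i] inj[of i "n + 1"] that last by (auto simp: le_Suc_eq)
  have "j \<noteq> k" using less.prems by auto
  have "j \<noteq> n + 1"
  proof
    assume "j = n + 1"
    then show False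
      using less.prems \<open>j \<noteq> k\<close> suffix_code_less_last[of k n w] by auto
  qed
  then have j: "j \<in> {1..n}" using less.prems by auto
  show ?case
  \<comment> \<open>Index \<open>n + 1\<close> has both the largest code and the largest orbit
    point.\<close>
  proof (cases "k = n + 1")
    case True
    then show ?thesis using mem'[OF j] last by simp
  next
    case False
    then have k: "k \<in> {1..n}" using less.prems by auto
    from less.prems(3) j k consider "w j < w k"
      | "w j = w k" "suffix_code n w (j + 1) < suffix_code n w (k + 1)"
      by (auto simp: suffix_code_Cons)
    then show ?thesis
    proof cases
      case 1
      then show ?thesis using monoD[OF \<open>mono b\<close>, of "?x k" "?x j"] by (fastforce simp: w_def)
    next
      case 2
      have "p (?x j) < p (?x k)"
        using less.hyps[of "j + 1" "k + 1"] j k 2(2) by auto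
      moreover have "p (?x k) < p (?x j)" if "?x k < ?x j"
        using p(2) mem'[OF j] mem'[OF k] 2(1) that by (simp add: block_increasing_def w_def)
      moreover have "?x j \<noteq> ?x k" using inj less.prems \<open>j \<noteq> k\<close> by simp
      ultimately show ?thesis by fastforce
    qed
  qed
qed

text \<open>The base point \<open>n + 1\<close> contributes no letter, its place being taken by the
  sentinel, so words have length \<open>n\<close>. Conversely, a word gives back its cycle by
  ranking the suffixes and sending each rank to that of the next suffix.\<close>

lemma bij_betw_cyc_perms_words:
  assumes "mono b"
  shows "bij_betw (\<lambda>p. restrict (\<lambda>j. b ((p ^^ j) (n + 1))) {1..n})
    {p \<in> cyc_perms (n + 1). block_increasing n b p} (words n b)"
    (is "bij_betw ?F ?S _")
proof (rule bij_betw_imageI)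
  show "inj_on ?F ?S"
  proof (rule inj_onI)
    fix p q assume p: "p \<in> ?S" and q: "q \<in> ?S" and eq: "?F p = ?F q"
    have orbit_rank: "(s ^^ j) (n + 1) = rank (suffix_code n (?F s)) {1..n + 1} j"
      if s: "s \<in> ?S" and "j \<in> {1..n + 1}" for s j
    proof (rule rank_unique)
      fix j k
      assume jk: "j \<in> {1..n + 1}" "k \<in> {1..n + 1}" "suffix_code n (?F s) j < suffix_code n (?F s) k"
      have "suffix_code n (?F s) i = suffix_code n (\<lambda>j. b ((s ^^ j) (n + 1))) i"
        if "i \<in> {1..n + 1}" for i
        using that by (intro suffix_code_cong) auto
      then show "(s ^^ j) (n + 1) < (s ^^ k) (n + 1)"
        using s assms jk by (intro funpow_less_of_suffix_code_less[of s n b j k]) auto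
    qed (use that inj_on_suffix_code cyc_perms_funpow[of s "n + 1"] in auto)
    have eq: "(p ^^ j) (n + 1) = (q ^^ j) (n + 1)" if "j \<in> {1..n + 1}" for j
      by (simp only: orbit_rank[OF p that] orbit_rank[OF q that] eq)
    show "p = q"
    proof
      fix x
      show "p x = q x"
      proof (cases "x \<in> {1..n + 1}")
        case True
        moreover have "(\<lambda>j. (p ^^ j) (n + 1)) ` {1..n + 1} = {1..n + 1}"
          using p by (intro bij_betw_imp_surj_on cyc_perms_funpow(1)) auto
        ultimately obtain j where j: "j \<in> {1..n + 1}" "x = (p ^^ j) (n + 1)"
          by blast
        \<comment> \<open>Both maps send the orbit point with index \<open>j\<close> to the one with
          index \<open>j + 1\<close>; from \<open>n + 1\<close> the next index is 1.\<close>
        show ?thesis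
        proof (cases "j = n + 1")
          case True
          then have "x = n + 1" using j p cyc_perms_funpow(2)[of p "n + 1"] by simp
          then show ?thesis using eq[of 1] by simp
        next
          case False
          then show ?thesis using j eq[of j] eq[of "j + 1"] by simp
        qed
      next
        case False
        have "p permutes {1..n + 1}" "q permutes {1..n + 1}"
          using p q by (auto simp: cyc_perms_def sym_perms_def)
        then show ?thesis using False by (metis permutes_not_in)
      qed
    qed
  qed
  show "?F ` ?S = words n b"
  proof (intro equalityI subsetI)
    fix w assume "w \<in> ?F ` ?S"
    then obtain p where p: "p \<in> cyc_perms (n + 1)" "w = ?F p" by blast
    \<comment> \<open>Index \<open>n + 1\<close> belongs to the point \<open>n + 1\<close>; the
      other indices therefore enumerate \<open>{1..n}\<close>.\<close>
    have "bij_betw (\<lambda>j. (p ^^ j) (n + 1)) ({1..n + 1} - {n + 1}) ({1..n + 1} - {n + 1})"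
      using cyc_perms_funpow[OF p(1)] by (intro bij_betw_DiffI) auto
    moreover have "{1..n + 1} - {n + 1} = {1..n}" by auto
    ultimately show "w \<in> words n b"
      using same_count_bij[of "\<lambda>j. (p ^^ j) (n + 1)" "{1..n}" w b] p(2)
      by (simp add: words_def)
  next
    fix w assume w: "w \<in> words n b"
    let ?N = "{1..n + 1}"
    define c where "c = suffix_code n w"
    define r where "r = rank c ?N"
    have r: "bij_betw r ?N ?N"
      using bij_betw_rank[of ?N c] inj_on_suffix_code by (simp add: r_def c_def)
    have less: "r j < r k \<longleftrightarrow> c j < c k" if "j \<in> ?N" "k \<in> ?N" for j k
      using that by (simp add: r_def rank_less_iff)
    have r_last: "r (n + 1) = n + 1"
    proof -
      have "{k \<in> ?N. c k \<le> c (n + 1)} = ?N"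
        using suffix_code_less_last[of _ n w] by (fastforce simp: c_def le_Suc_eq)
      then show ?thesis by (simp add: r_def rank_def)
    qed
    have "bij_betw r (?N - {n + 1}) (?N - {n + 1})"
      using r r_last by (intro bij_betw_DiffI) auto
    moreover have "?N - {n + 1} = {1..n}" by auto
    ultimately have r': "bij_betw r {1..n} {1..n}" by simp
    have block: "b (r j) = w j" if "j \<in> {1..n}" for j
    proof (rule block_of_sorted_position[OF assms _ r' _ that])
      show "same_count {1..n} w b" using w by (simp add: words_def)
      show "r j < r k" if "j \<in> {1..n}" "k \<in> {1..n}" "w j < w k" for j k
        using that less[of j k] by (simp add: c_def suffix_code_Cons)
    qed
    \<comment> \<open>\<open>succ\<close> is the cyclic shift of the indices, and \<open>p\<close>
      is its conjugate by \<open>r\<close>: it maps the rank of a suffix to the rank of the next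
      one, and that of the sentinel alone to that of the whole word.\<close>
    define succ where "succ j = (if j = n + 1 then 1 else j + 1)" for j
    define p where "p x = (if x \<in> ?N then r (succ (inv_into ?N r x)) else x)" for x
    have p_r: "p (r j) = r (succ j)" if "j \<in> ?N" for j
      using that r bij_betw_inv_into_left[OF r that] by (auto simp: p_def bij_betw_def)
    have "succ ` ?N = ?N"
    proof
      show "?N \<subseteq> succ ` ?N"
      proof
        fix x assume "x \<in> ?N"
        then show "x \<in> succ ` ?N"
          by (intro image_eqI[of _ _ "if x = 1 then n + 1 else x - 1"]) (auto simp: succ_def)
      qed
    qed (auto simp: succ_def)
    then have "p ` ?N = ?N"
      using r p_r by (metis (no_types, lifting) bij_betw_def image_cong image_image)
    then have "bij_betw p ?N ?N"
      by (auto simp: bij_betw_def intro!: eq_card_imp_inj_on)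
    then have perm: "p permutes ?N"
      by (rule bij_imp_permutes) (auto simp: p_def)
    have pow: "(p ^^ j) (n + 1) = r j" if "1 \<le> j" "j \<le> n + 1" for j
      using that
    proof (induction j rule: dec_induct)
      case base
      then show ?case using p_r[of "n + 1"] r_last by (simp add: succ_def)
    next
      case (step j)
      then show ?case using p_r[of j] by (simp add: succ_def)
    qed
    have "?N \<subseteq> orbit p (n + 1)"
    proof
      fix x assume "x \<in> ?N"
      then have "x \<in> r ` ?N" using r by (simp only: bij_betw_imp_surj_on)
      then obtain j where "j \<in> ?N" "x = r j" by blast
      then show "x \<in> orbit p (n + 1)"
        using pow[of j] by (auto simp: orbit_altdef intro!: exI[of _ j])
    qed
    then have "cyclic_on p ?N"
      using permutes_orbit_subset[OF perm, of "n + 1"] by (intro cyclic_on_singleI[of "n + 1"]) auto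
    then have cyc: "p \<in> cyc_perms (n + 1)" using perm by (simp add: cyc_perms_def sym_perms_def)
    have inc: "block_increasing n b p"
      unfolding block_increasing_def
    proof (intro ballI impI)
      fix x y assume xy: "x \<in> {1..n}" "y \<in> {1..n}" "x < y" "b x = b y"
      then obtain j k where jk: "j \<in> {1..n}" "k \<in> {1..n}" "x = r j" "y = r k"
        using r' by (metis bij_betw_def image_iff)
      \<comment> \<open>Equal first letters can be stripped from both codes. Since \<open>j\<close>
        and \<open>k\<close> are at most \<open>n\<close>, \<open>succ\<close> does not wrap around
        here.\<close>
      then have "c (j + 1) < c (k + 1)"
        using xy less[of j k] block by (auto simp: c_def suffix_code_Cons)
      then show "p x < p y"
        using jk p_r[of j] p_r[of k] less[of "j + 1" "k + 1"] by (simp add: succ_def)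
    qed
    have "?F p = w"
      using w pow block by (intro extensionalityI[of _ "{1..n}"]) (auto simp: words_def)
    then show "w \<in> ?F ` ?S" using inc cyc by blast
  qed
qed

section \<open>Descent sets\<close>

text \<open>The label of \<open>p\<close> counts the cuts before \<open>p\<close>, so it changes
  from \<open>i\<close> to \<open>i + 1\<close> exactly when \<open>i\<close> lies in
  \<open>I\<close>. Keeping \<open>m\<close> apart from \<open>n\<close> serves both sides of the
  theorem, with \<open>m = n\<close> and \<open>m = n + 1\<close>.\<close>

lemma descents_subset_iff_block_increasing:
  assumes "finite I" "inj_on s {1..n}" "n \<le> m"
  shows "descent_set m s \<inter> {1..n - 1} \<subseteq> I \<longleftrightarrow>
    block_increasing n (\<lambda>p. card {i \<in> I. i < p}) s"
proof
  let ?b = "\<lambda>p. card {i \<in> I. i < p}"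
  have mono: "?b p \<le> ?b q" if "p \<le> q" for p q
    using that assms(1) by (intro card_mono) auto
  show "block_increasing n ?b s" if sub: "descent_set m s \<inter> {1..n - 1} \<subseteq> I"
    unfolding block_increasing_def
  proof (intro ballI impI)
    fix p q assume pq: "p \<in> {1..n}" "q \<in> {1..n}" "p < q" "?b p = ?b q"
    \<comment> \<open>Equal labels leave no element of \<open>I\<close> from \<open>p\<close> to
      \<open>q - 1\<close>, so no descent is allowed there; injectivity excludes equality.\<close>
    have ascent: "s i < s (Suc i)" if "p \<le> i" "i < q" for i
    proof -
      have "i \<notin> I"
      proof
        assume "i \<in> I"
        then have "?b i < ?b q" using assms(1) that by (intro psubset_card_mono) auto
        then show False using mono[OF that(1)] pq(4) by simp
      qed
      then have "i \<notin> descent_set m s" using sub that pq by auto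
      then have "\<not> s (Suc i) < s i" using that pq assms(3) by (auto simp: descent_set_def)
      moreover have "s i \<noteq> s (Suc i)"
        using assms(2) that pq by (auto dest: inj_onD)
      ultimately show ?thesis by simp
    qed
    have "Suc p \<le> q" using pq(3) by simp
    have "s p < s k" if "Suc p \<le> k" "k \<le> q" for k
      using that
    proof (induction k rule: dec_induct)
      case base
      then show ?case using ascent[of p] by simp
    next
      case (step k)
      then show ?case using ascent[of k] by simp
    qed
    then show "s p < s q" using \<open>Suc p \<le> q\<close> by blast
  qed
  show "descent_set m s \<inter> {1..n - 1} \<subseteq> I" if inc: "block_increasing n ?b s"
  proof (rule subsetI, rule ccontr)
    fix i assume i: "i \<in> descent_set m s \<inter> {1..n - 1}" "i \<notin> I"
    then have "{k \<in> I. k < i} = {k \<in> I. k < i + 1}" by (auto simp: less_Suc_eq)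
    then have "?b i = ?b (i + 1)" by (simp only:)
    moreover have "i \<in> {1..n}" "i + 1 \<in> {1..n}" using i(1) by auto
    ultimately have "s i < s (i + 1)"
      using inc unfolding block_increasing_def by (meson less_add_one)
    then show False using i by (simp add: descent_set_def)
  qed
qed

text \<open>Both families are in bijection with \<open>words n b\<close>, where \<open>b\<close>
  labels the blocks cut out by \<open>I\<close>.\<close>

lemma card_descents_subset_eq:
  assumes "finite I"
  shows "card {p \<in> cyc_perms (n + 1). descent_set (n + 1) p \<inter> {1..n - 1} \<subseteq> I}
       = card {s \<in> sym_perms n. descent_set n s \<subseteq> I}"
proof -
  define b where "b = (\<lambda>p. card {i \<in> I. i < p})"
  have "mono b" unfolding b_def using assms by (intro monoI card_mono) auto
  have "descent_set (n + 1) p \<inter> {1..n - 1} \<subseteq> I \<longleftrightarrow> block_increasing n b p"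
    if "p \<in> cyc_perms (n + 1)" for p
    unfolding b_def using that assms
    by (intro descents_subset_iff_block_increasing)
       (auto simp: cyc_perms_def sym_perms_def intro: permutes_inj_on)
  then have "{p \<in> cyc_perms (n + 1). descent_set (n + 1) p \<inter> {1..n - 1} \<subseteq> I} =
      {p \<in> cyc_perms (n + 1). block_increasing n b p}" by blast
  moreover have "descent_set n s \<subseteq> I \<longleftrightarrow> block_increasing n b s" if "s permutes {1..n}" for s
  proof -
    have "descent_set n s \<inter> {1..n - 1} = descent_set n s" by (auto simp: descent_set_def)
    then show ?thesis
      using descents_subset_iff_block_increasing[OF assms permutes_inj_on[OF that], of n n]
      by (simp add: b_def)
  qed
  then have "{s \<in> sym_perms n. descent_set n s \<subseteq> I} =
      {s. s permutes {1..n} \<and> block_increasing n b s}" by (auto simp: sym_perms_def)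
  ultimately show ?thesis
    using bij_betw_same_card[OF bij_betw_cyc_perms_words[OF \<open>mono b\<close>, of n]]
      bij_betw_same_card[OF bij_betw_perm_words[OF \<open>mono b\<close>, of n]] by simp
qed

text \<open>This is inclusion-exclusion in inductive form: the containment count at \<open>I\<close>
  is the sum of the exact counts over all subsets of \<open>I\<close>, and those for proper subsets
  agree by the induction hypothesis.\<close>

lemma card_eq_of_card_subset_eq:
  assumes "finite X" "finite Y" "finite I"
    and eq: "\<And>J. finite J \<Longrightarrow> card {x \<in> X. f x \<subseteq> J} = card {y \<in> Y. g y \<subseteq> J}"
  shows "card {x \<in> X. f x = I} = card {y \<in> Y. g y = I}"
  using assms(3)
proof (induction I rule: finite_psubset_induct)
  case (psubset I)
  \<comment> \<open>Stated for an arbitrary \<open>Z\<close> and \<open>h\<close>, to be applied to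
    \<open>X\<close> with \<open>f\<close> and to \<open>Y\<close> with \<open>g\<close>.\<close>
  have split: "card {z \<in> Z. h z \<subseteq> I} = (\<Sum>J\<in>{J. J \<subset> I}. card {z \<in> Z. h z = J}) + card {z \<in> Z. h z = I}"
    if "finite Z" for Z :: "'z set" and h
  proof -
    have fin: "finite {J. J \<subset> I}" using psubset.hyps by (auto intro: finite_subset[of _ "Pow I"])
    have "{z \<in> Z. h z \<subseteq> I} = (\<Union>J\<in>insert I {J. J \<subset> I}. {z \<in> Z. h z = J})" by auto
    then have "card {z \<in> Z. h z \<subseteq> I} = (\<Sum>J\<in>insert I {J. J \<subset> I}. card {z \<in> Z. h z = J})"
      using fin that by (simp only:) (subst card_UN_disjoint, auto)
    then show ?thesis using fin by simp
  qed
  have "(\<Sum>J\<in>{J. J \<subset> I}. card {x \<in> X. f x = J}) = (\<Sum>J\<in>{J. J \<subset> I}. card {y \<in> Y. g y = J})"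
    using psubset.IH by (intro sum.cong) auto
  then show ?case using split[OF assms(1), of f] split[OF assms(2), of g] eq[OF psubset.hyps] by simp
qed

theorem corollary4p1:
  fixes n :: nat and I :: "nat set"
  assumes "n \<ge> 1" and "I \<subseteq> {1..n - 1}"
  shows "card {p \<in> cyc_perms (n + 1). descent_set (n + 1) p \<inter> {1..n - 1} = I}
       = card {s \<in> sym_perms n. descent_set n s = I}"
proof (rule card_eq_of_card_subset_eq)
  show "finite (cyc_perms (n + 1))" "finite (sym_perms n)"
    by (auto simp: cyc_perms_def sym_perms_def finite_permutations)
  show "finite I" using assms(2) by (rule finite_subset) simp
qed (rule card_descents_subset_eq)

end
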